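(* On each orientable surface of genus $g$ there are $\Delta^{\hat 0}$-chiral hypermaps (that is, irregular bipartite-regular hypermaps) with irregularity indices $2g+1$, $4g+2$ and $4g$.
   Context: A hypermap is a tuple $\mathcal{H}=(\Omega;h_0,h_1,h_2)$, where $\Omega$ is a non-empty finite set (of flags) and $h_0,h_1,h_2$ are fixed-point-free involutory permutations of $\Omega$ generating a group transitive on $\Omega$. For $\{i,j,k\}=\{0,1,2\}$ the $k$-faces are the $\langle h_i,h_j\rangle$-orbits; with $V,E,F$ the numbers of $0$-, $1$-, $2$-faces, the Euler characteristic is $V+E+F-|\Omega|/2$. Let $\Delta=\langle R_0,R_1,R_2\mid R_0^2=R_1^2=R_2^2=1\rangle$, acting on $\Omega$ by $R_i\mapsto h_i$; the stabiliser $K\le\Delta$ of a flag is a hypermap subgroup (unique up to conjugation). The hypermap is regular if $K\lhd\Delta$ and irregular otherwise. It is orientable if $K\le\langle R_1R_2,R_2R_0\rangle$; it lies on the orientable surface of genus $g$ if it is orientable and its Euler characteristic is $2-2g$. Surfaces are compact, connected and without boundary. $\Delta^{\hat 0}$ is the normal closure of $\{R_1,R_2\}$ in $\Delta$ (index $2$). The hypermap is bipartite-regular if $K\lhd\Delta^{\hat 0}$ (in particular $K\le\Delta^{\hat 0}$); a bipartite-regular hypermap is $\Delta^{\hat 0}$-chiral (bipartite-chiral) if it is not regular. The irregularity index of a bipartite-regular hypermap is $|K^{\Delta}:K|$, where $K^\Delta$ is the normal closure of $K$ in $\Delta$ (it equals $|K:K_\Delta|$, with $K_\Delta$ the core of $K$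 in $\Delta$).
   Formalization: For irregularity indices 2g+1 and 4g the genus is taken to be at least 1: at genus 0 these would be 1, which forces the hypermap to be regular, and 0, which is impossible; index 4g+2 is claimed for every genus. *)

theory Defs
  imports Complex_Main "HOL-Algebra.Group_Action" "HOL-Algebra.Generated_Groups"
begin

datatype idx = I0 | I1 | I2

text \<open>The group with generators \<open>R\<^sub>0, R\<^sub>1, R\<^sub>2\<close> and relations \<open>R\<^sub>i\<^sup>2 = 1\<close>. As the relations make
  each generator its own inverse, the group is the quotient of the monoid of positive words
  by the congruence generated by \<open>R\<^sub>i R\<^sub>i = 1\<close>; no letters for inverses are needed.\<close>

inductive word_eq :: "idx list \<Rightarrow> idx list \<Rightarrow> bool" where
  word_eq_refl: "word_eq w w"
| word_eq_sym: "word_eq v w \<Longrightarrow> word_eq w v"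
| word_eq_trans: "word_eq u v \<Longrightarrow> word_eq v w \<Longrightarrow> word_eq u w"
| word_eq_cancel: "word_eq (u @ [i, i] @ v) (u @ v)"

lemma word_eq_equivp: "equivp word_eq"
  by (intro equivpI reflpI sympI transpI) (blast intro: word_eq.intros)+

lemma word_eq_context: "word_eq v w \<Longrightarrow> word_eq (a @ v @ b) (a @ w @ b)"
proof (induction rule: word_eq.induct)
  case (word_eq_cancel u i v)
  show ?case using word_eq.word_eq_cancel[of "a @ u" i "v @ b"] by simp
qed (blast intro: word_eq.intros)+

lemma word_eq_append: "word_eq v v' \<Longrightarrow> word_eq w w' \<Longrightarrow> word_eq (v @ w) (v' @ w')"
  using word_eq_context[of v v' "[]" w] word_eq_context[of w w' v' "[]"]
  by (auto intro: word_eq_trans)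

lemma word_eq_rev: "word_eq (rev w @ w) []"
proof (induction w)
  case (Cons i w)
  have "word_eq (rev w @ [i, i] @ w) (rev w @ w)"
    by (rule word_eq_cancel)
  with Cons show ?case by (auto intro: word_eq_trans)
qed (simp add: word_eq_refl)

quotient_type delta = "idx list" / word_eq
  by (rule word_eq_equivp)

lift_definition delta_one :: delta is "[]" .

lift_definition delta_mult :: "delta \<Rightarrow> delta \<Rightarrow> delta" is "(@)"
  by (rule word_eq_append)

lift_definition Rgen :: "idx \<Rightarrow> delta" is "\<lambda>i. [i]" .

definition Delta :: "delta monoid" where
  "Delta = \<lparr>carrier = UNIV, mult = delta_mult, one = delta_one\<rparr>"

lemma Rgen_square: "Rgen i \<otimes>\<^bsub>Delta\<^esub> Rgen i = \<one>\<^bsub>Delta\<^esub>"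
  unfolding Delta_def monoid.simps
  by transfer (use word_eq_cancel[of "[]" _ "[]"] in simp)

lemma Delta_group: "group Delta"
proof (rule groupI)
  fix x y z :: delta
  show "x \<otimes>\<^bsub>Delta\<^esub> y \<otimes>\<^bsub>Delta\<^esub> z = x \<otimes>\<^bsub>Delta\<^esub> (y \<otimes>\<^bsub>Delta\<^esub> z)"
    unfolding Delta_def monoid.simps by transfer (simp add: word_eq_refl)
  show "\<one>\<^bsub>Delta\<^esub> \<otimes>\<^bsub>Delta\<^esub> x = x"
    unfolding Delta_def monoid.simps by transfer (simp add: word_eq_refl)
  have "\<exists>y. delta_mult y x = delta_one"
    by transfer (use word_eq_rev in blast)
  then show "\<exists>y\<in>carrier Delta. y \<otimes>\<^bsub>Delta\<^esub> x = \<one>\<^bsub>Delta\<^esub>"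
    by (simp add: Delta_def)
qed (simp_all add: Delta_def)

definition normal_closure :: "('a, 'b) monoid_scheme \<Rightarrow> 'a set \<Rightarrow> 'a set" where
  "normal_closure G S = \<Inter> {N. N \<lhd> G \<and> S \<subseteq> N}"

definition Delta_0hat :: "delta set" where
  "Delta_0hat = normal_closure Delta {Rgen I1, Rgen I2}"

definition subgroup_index :: "('a, 'b) monoid_scheme \<Rightarrow> 'a set \<Rightarrow> 'a set \<Rightarrow> nat" where
  "subgroup_index G A B = card (rcosets\<^bsub>G\<lparr>carrier := A\<rparr>\<^esub> B)"

record 'a hypermap =
  flags :: "'a set"
  perm :: "idx \<Rightarrow> 'a \<Rightarrow> 'a"

definition hypermap :: "'a hypermap \<Rightarrow> bool" where
  "hypermap H \<longleftrightarrow>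
     finite (flags H) \<and> flags H \<noteq> {} \<and>
     (\<forall>i. perm H i \<in> carrier (BijGroup (flags H))) \<and>
     (\<forall>i. \<forall>x\<in>flags H. perm H i x \<noteq> x \<and> perm H i (perm H i x) = x) \<and>
     (\<forall>x\<in>flags H. \<forall>y\<in>flags H.
        \<exists>g\<in>generate (BijGroup (flags H)) (range (perm H)). g x = y)"

definition faces :: "'a hypermap \<Rightarrow> idx \<Rightarrow> 'a set set" where
  "faces H k =
     orbits (BijGroup (flags H)
              \<lparr>carrier := generate (BijGroup (flags H)) {perm H i | i. i \<noteq> k}\<rparr>)
            (flags H) (\<lambda>g. g)"

definition euler_char :: "'a hypermap \<Rightarrow> real" where
  "euler_char H = real (card (faces H I0)) + real (card (faces H I1)) + real (card (faces H I2))
     - real (card (flags H)) / 2"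

text \<open>The action of \<open>Delta\<close> on the flags with \<open>R\<^sub>i \<mapsto> h\<^sub>i\<close>. The choice of a representing word is
  immaterial for hypermaps, see \<open>act_abs\<close> below. This is a left action; the right action with the
  same effect of the generators has the same stabilisers, because it is obtained by inverting the
  acting element.\<close>

definition act :: "'a hypermap \<Rightarrow> delta \<Rightarrow> 'a \<Rightarrow> 'a" where
  "act H d = restrict (foldr (perm H) (rep_delta d)) (flags H)"

text \<open>Another choice of the flag gives a conjugate subgroup, see \<open>stabilizer_conjugate\<close> below;
  everything derived from \<open>hypermap_subgroup\<close> in the sequel is invariant under conjugation.\<close>

definition hypermap_subgroup :: "'a hypermap \<Rightarrow> delta set" where
  "hypermap_subgroup H = stabilizer Delta (act H) (SOME x. x \<in> flags H)"

definition regular :: "'a hypermap \<Rightarrow> bool" where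
  "regular H \<longleftrightarrow> hypermap_subgroup H \<lhd> Delta"

definition orientable :: "'a hypermap \<Rightarrow> bool" where
  "orientable H \<longleftrightarrow>
     hypermap_subgroup H \<subseteq>
       generate Delta {Rgen I1 \<otimes>\<^bsub>Delta\<^esub> Rgen I2, Rgen I2 \<otimes>\<^bsub>Delta\<^esub> Rgen I0}"

definition on_orientable_surface :: "'a hypermap \<Rightarrow> nat \<Rightarrow> bool" where
  "on_orientable_surface H g \<longleftrightarrow> orientable H \<and> euler_char H = 2 - 2 * real g"

definition bipartite_regular :: "'a hypermap \<Rightarrow> bool" where
  "bipartite_regular H \<longleftrightarrow> hypermap_subgroup H \<lhd> Delta\<lparr>carrier := Delta_0hat\<rparr>"

definition bipartite_chiral :: "'a hypermap \<Rightarrow> bool" where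
  "bipartite_chiral H \<longleftrightarrow> bipartite_regular H \<and> \<not> regular H"

definition irregularity_index :: "'a hypermap \<Rightarrow> nat" where
  "irregularity_index H =
     subgroup_index Delta (normal_closure Delta (hypermap_subgroup H)) (hypermap_subgroup H)"

lemma perm_flags: "hypermap H \<Longrightarrow> x \<in> flags H \<Longrightarrow> perm H i x \<in> flags H"
  unfolding hypermap_def BijGroup_def Bij_def by (auto dest!: spec[of _ i] bij_betwE)

lemma foldr_perm_flags: "hypermap H \<Longrightarrow> x \<in> flags H \<Longrightarrow> foldr (perm H) w x \<in> flags H"
  by (induction w) (auto intro: perm_flags)

lemma foldr_perm_cong:
  assumes H: "hypermap H"
  shows "word_eq v w \<Longrightarrow> x \<in> flags H \<Longrightarrow> foldr (perm H) v x = foldr (perm H) w x"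
proof (induction arbitrary: x rule: word_eq.induct)
  case (word_eq_cancel u i v)
  have "foldr (perm H) v x \<in> flags H"
    using H word_eq_cancel by (rule foldr_perm_flags)
  then show ?case using H by (simp add: hypermap_def)
qed auto

lemma act_abs:
  assumes H: "hypermap H"
  shows "act H (abs_delta w) = restrict (foldr (perm H) w) (flags H)"
proof -
  have "word_eq (rep_delta (abs_delta w)) w"
    by (metis Quotient3_delta Quotient3_rel_abs Quotient3_rel_rep delta.abs_eq_iff Quotient3_abs_rep)
  then show ?thesis unfolding act_def
    using foldr_perm_cong[OF H] by (auto intro!: restrict_ext)
qed

lemma act_Rgen: "hypermap H \<Longrightarrow> act H (Rgen i) = perm H i"
  by (auto simp: Rgen.abs_eq act_abs hypermap_def BijGroup_def Bij_def intro: extensional_restrict)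

lemma act_mult:
  assumes H: "hypermap H"
  shows "act H (d \<otimes>\<^bsub>Delta\<^esub> e) = compose (flags H) (act H d) (act H e)"
proof -
  obtain v w where vw: "d = abs_delta v" "e = abs_delta w"
    by (metis Quotient3_abs_rep[OF Quotient3_delta])
  have "act H (d \<otimes>\<^bsub>Delta\<^esub> e) = restrict (foldr (perm H) (v @ w)) (flags H)"
    by (simp add: vw Delta_def delta_mult.abs_eq act_abs[OF H])
  also have "\<dots> = compose (flags H) (act H d) (act H e)"
    by (auto simp: vw act_abs[OF H] compose_def foldr_perm_flags[OF H] intro!: restrict_ext)
  finally show ?thesis .
qed

lemma act_one:
  assumes "hypermap H"
  shows "act H \<one>\<^bsub>Delta\<^esub> = (\<lambda>x\<in>flags H. x)"
  using act_abs[OF assms, of "[]"] by (simp add: Delta_def delta_one_def id_def)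

lemma act_Bij:
  assumes H: "hypermap H"
  shows "act H d \<in> Bij (flags H)"
proof -
  interpret group Delta by (rule Delta_group)
  have c: "d \<in> carrier Delta" by (simp add: Delta_def)
  have inv: "compose (flags H) (act H d) (act H (inv\<^bsub>Delta\<^esub> d)) = (\<lambda>x\<in>flags H. x)"
    "compose (flags H) (act H (inv\<^bsub>Delta\<^esub> d)) (act H d) = (\<lambda>x\<in>flags H. x)"
    using c by (simp_all flip: act_mult[OF H] add: act_one[OF H])
  have cl: "act H e x \<in> flags H" if "x \<in> flags H" for e x
    using that by (simp add: act_def foldr_perm_flags[OF H])
  have "bij_betw (act H d) (flags H) (flags H)"
  proof (rule bij_betw_byWitness[where f' = "act H (inv\<^bsub>Delta\<^esub> d)"])
    show "\<forall>a\<in>flags H. act H (inv\<^bsub>Delta\<^esub> d) (act H d a) = a"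
      using fun_cong[OF inv(2)] by (metis compose_eq restrict_apply')
    show "\<forall>a\<in>flags H. act H d (act H (inv\<^bsub>Delta\<^esub> d) a) = a"
      using fun_cong[OF inv(1)] by (metis compose_eq restrict_apply')
  qed (use cl in auto)
  then show ?thesis by (simp add: Bij_def act_def)
qed

lemma act_group_action:
  assumes H: "hypermap H"
  shows "group_action Delta (flags H) (act H)"
  unfolding group_action_def group_hom_def group_hom_axioms_def
  using act_Bij[OF H] act_mult[OF H]
  by (auto simp: Delta_group group_BijGroup) (auto simp: hom_def BijGroup_def)

lemma act_generate:
  assumes H: "hypermap H" and g: "g \<in> generate (BijGroup (flags H)) (range (perm H))"
  shows "\<exists>d. act H d = g"
proof -
  interpret A: group_action Delta "flags H" "act H" by (rule act_group_action[OF H])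
  interpret h: group_hom Delta "BijGroup (flags H)" "act H" by (rule A.group_hom)
  have "act H ` carrier Delta = range (act H)" by (simp add: Delta_def)
  then have "subgroup (range (act H)) (BijGroup (flags H))"
    using h.img_is_subgroup by simp
  moreover have "range (perm H) \<subseteq> range (act H)"
    using act_Rgen[OF H] by (metis image_subsetI rangeI)
  ultimately have "generate (BijGroup (flags H)) (range (perm H)) \<subseteq> range (act H)"
    using h.H.generate_subgroup_incl by blast
  with g show ?thesis by auto
qed

lemma stabilizer_conjugate:
  assumes H: "hypermap H" and xy: "x \<in> flags H" "y \<in> flags H"
  shows "\<exists>d. stabilizer Delta (act H) y =
    (\<lambda>k. d \<otimes>\<^bsub>Delta\<^esub> k \<otimes>\<^bsub>Delta\<^esub> inv\<^bsub>Delta\<^esub> d) ` stabilizer Delta (act H) x"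
proof -
  interpret A: group_action Delta "flags H" "act H" by (rule act_group_action[OF H])
  interpret group Delta by (rule Delta_group)
  have [simp]: "d \<in> carrier Delta" for d by (simp add: Delta_def)
  obtain d where d: "act H d x = y"
    using H xy act_generate[OF H] unfolding hypermap_def by metis
  have i: "act H (inv\<^bsub>Delta\<^esub> d) y = x"
    using A.orbit_sym_aux[OF _ xy(1) d] by simp
  note comp = A.composition_rule[OF xy(1)] A.composition_rule[OF xy(2)]
  have 1: "d \<otimes>\<^bsub>Delta\<^esub> k \<otimes>\<^bsub>Delta\<^esub> inv\<^bsub>Delta\<^esub> d \<in> stabilizer Delta (act H) y"
    if "k \<in> stabilizer Delta (act H) x" for k
    using that by (simp add: stabilizer_def comp i d)
  have 2: "inv\<^bsub>Delta\<^esub> d \<otimes>\<^bsub>Delta\<^esub> k \<otimes>\<^bsub>Delta\<^esub> d \<in> stabilizer Delta (act H) x"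
    if "k \<in> stabilizer Delta (act H) y" for k
    using that by (simp add: stabilizer_def comp i d)
  have 3: "k = d \<otimes>\<^bsub>Delta\<^esub> (inv\<^bsub>Delta\<^esub> d \<otimes>\<^bsub>Delta\<^esub> k \<otimes>\<^bsub>Delta\<^esub> d) \<otimes>\<^bsub>Delta\<^esub> inv\<^bsub>Delta\<^esub> d" for k
    by (simp add: m_assoc) (simp flip: m_assoc)
  show ?thesis using 1 2 3 by (intro exI[of _ d]) blast
qed

end

theory Submission
  imports Defs "HOL-Library.Countable"
begin

text \<open>
  All three families are instances of one construction with a dihedral group. The subgroup
  \<open>\<Delta>\<^sup>0\<close> (the normal closure of \<open>R\<^sub>1\<close> and \<open>R\<^sub>2\<close>) is the free product of the four groups of order two
  generated by \<open>R\<^sub>1\<close>, \<open>R\<^sub>2\<close>, \<open>R\<^sub>0R\<^sub>1R\<^sub>0\<close>, \<open>R\<^sub>0R\<^sub>2R\<^sub>0\<close>, so these four elements may be sent to any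
  involutions of any group. Send them to the reflections \<open>\<sigma>\<close>, \<open>\<sigma>\<close>, \<open>\<rho>\<^sup>x\<^sup>+\<^sup>1\<sigma>\<close>, \<open>\<rho>\<^sup>x\<sigma>\<close> of the dihedral group
  \<open>D = \<langle>\<rho>, \<sigma>\<rangle>\<close> of order \<open>2n\<close>. They generate \<open>D\<close>, and the kernel \<open>K\<close> is the subgroup of a
  bipartite-regular hypermap with \<open>4n\<close> flags.

  Index. Conjugation by \<open>R\<^sub>0\<close> exchanges the first two generators with the last two. Since \<open>K\<close> contains
  \<open>R\<^sub>2R\<^sub>1\<close>, its normal closure contains the conjugate of this element, which is mapped to
  \<open>\<rho>\<^sup>x\<sigma> \<cdot> \<rho>\<^sup>x\<^sup>+\<^sup>1\<sigma> = \<rho>\<^sup>-\<^sup>1\<close>. So the image of the normal closure of \<open>K\<close> in \<open>D\<close> contains all rotations; it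
  contains no reflections, because \<open>K\<close> consists of words with an even number of letters \<open>R\<^sub>1\<close>, \<open>R\<^sub>2\<close>,
  a property that defines a normal subgroup of \<open>\<Delta>\<close>. The irregularity index is therefore \<open>n\<close>
  (\<open>index_stabilizer\<close>), and the hypermap is irregular as soon as \<open>n \<ge> 2\<close>.

  Genus. The faces of each kind correspond to the orbits on \<open>D\<close> of a dihedral subgroup generated by two of
  the four reflections, and two reflections that differ by \<open>\<rho>\<^sup>t\<close> yield \<open>gcd(n, t)\<close> orbits on \<open>D\<close>. The differences
  for the two kinds of vertices, the edges and the faces are \<open>0\<close>, \<open>1\<close>, \<open>x\<close>, \<open>x + 1\<close>, whence the Euler
  characteristic is \<open>n + 1 + gcd(n, x) + gcd(n, x + 1) - 2n\<close> (\<open>euler_char_H\<close>).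

  It remains to find \<open>x\<close> with \<open>gcd(n, x) + gcd(n, x + 1) = n + 1 - 2g\<close>:
  \<^item> \<open>n = 2g + 1\<close>, \<open>x = 1\<close>: both divisors are \<open>1\<close>, as \<open>n\<close> is odd;
  \<^item> \<open>n = 4g + 2\<close>, \<open>x = n/2 = 2g + 1\<close>: the divisors are \<open>n/2\<close> and \<open>2\<close>;
  \<^item> \<open>n = 4g\<close>, \<open>x = n/2 = 2g\<close>: the divisors are \<open>n/2\<close> and \<open>1\<close>.
\<close>

section \<open>Orbits of generated permutation groups\<close>

definition linked :: "'a set \<Rightarrow> ('a \<Rightarrow> 'a) set \<Rightarrow> 'a \<Rightarrow> 'a \<Rightarrow> bool" where
  "linked F S v w \<longleftrightarrow> (\<exists>q \<in> generate (BijGroup F) S. q v = w)"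

lemma linked_refl: "v \<in> F \<Longrightarrow> linked F S v v"
  unfolding linked_def
  by (intro bexI[of _ "\<one>\<^bsub>BijGroup F\<^esub>"] generate.one) (simp add: BijGroup_def)

lemma generate_BijGroup_Bij: "S \<subseteq> Bij F \<Longrightarrow> q \<in> generate (BijGroup F) S \<Longrightarrow> q \<in> Bij F"
  using group.generate_in_carrier[OF group_BijGroup, of S F q] by (simp add: BijGroup_def)

lemma linked_step:
  assumes S: "S \<subseteq> Bij F" and "p \<in> S" "v \<in> F" "linked F S v w"
  shows "linked F S v (p w)"
proof -
  obtain q where q: "q \<in> generate (BijGroup F) S" "q v = w"
    using assms(4) by (auto simp: linked_def)
  have "p \<in> Bij F" "q \<in> Bij F" using assms q generate_BijGroup_Bij by blast+
  then have "(p \<otimes>\<^bsub>BijGroup F\<^esub> q) v = p w"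
    using q \<open>v \<in> F\<close> by (simp add: BijGroup_def compose_eq)
  then show ?thesis
    unfolding linked_def using generate.eng[OF generate.incl[OF \<open>p \<in> S\<close>] q(1)] by blast
qed

lemma generate_BijGroup_invariant:
  assumes S: "S \<subseteq> Bij F"
    and inv: "\<And>p v. p \<in> S \<Longrightarrow> v \<in> F \<Longrightarrow> f (p v) = f v"
    and "q \<in> generate (BijGroup F) S" "v \<in> F"
  shows "f (q v) = f v"
  using assms(3,4)
proof (induction arbitrary: v rule: generate.induct)
  case one
  then show ?case by (simp add: BijGroup_def)
next
  case (incl h)
  then show ?case by (rule inv)
next
  case (inv h)
  then have h: "h \<in> Bij F" "bij_betw h F F" using S by (auto simp: Bij_def)
  then have "inv_into F h v \<in> F" "h (inv_into F h v) = v"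
    using inv(2) by (auto simp: bij_betw_def inv_into_into f_inv_into_f)
  then show ?case
    using assms(2)[OF inv(1), of "inv_into F h v"] h inv(2) by (simp add: inv_BijGroup)
next
  case (eng h1 h2)
  have B: "h1 \<in> Bij F" "h2 \<in> Bij F" using eng generate_BijGroup_Bij[OF S] by auto
  then have "h2 v \<in> F" using eng by (auto simp: Bij_def dest: bij_betwE)
  with eng B show ?case by (simp add: BijGroup_def compose_eq)
qed

text \<open>Orbits are counted by a complete invariant \<open>f\<close>: it is constant along the generators, and flags
  with the same value are connected. Then the orbits are exactly the fibres of \<open>f\<close>.\<close>

lemma card_orbits_generate:
  assumes S: "S \<subseteq> Bij F"
    and inv: "\<And>p v. p \<in> S \<Longrightarrow> v \<in> F \<Longrightarrow> f (p v) = f v"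
    and sep: "\<And>v w. v \<in> F \<Longrightarrow> w \<in> F \<Longrightarrow> f v = f w \<Longrightarrow> linked F S v w"
  shows "card (orbits (BijGroup F\<lparr>carrier := generate (BijGroup F) S\<rparr>) F (\<lambda>q. q)) = card (f ` F)"
proof -
  have orb: "orbit (BijGroup F\<lparr>carrier := generate (BijGroup F) S\<rparr>) (\<lambda>q. q) v = {w \<in> F. f w = f v}"
    if "v \<in> F" for v
  proof
    show "{w \<in> F. f w = f v} \<subseteq> orbit (BijGroup F\<lparr>carrier := generate (BijGroup F) S\<rparr>) (\<lambda>q. q) v"
      using sep[OF that] by (force simp: orbit_def linked_def)
    have "q v \<in> F" if "q \<in> generate (BijGroup F) S" for q
      using generate_BijGroup_Bij[OF S that] \<open>v \<in> F\<close> by (auto simp: Bij_def dest: bij_betwE)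
    then show "orbit (BijGroup F\<lparr>carrier := generate (BijGroup F) S\<rparr>) (\<lambda>q. q) v \<subseteq> {w \<in> F. f w = f v}"
      using generate_BijGroup_invariant[where f = f and S = S and F = F] S inv that
      by (auto simp: orbit_def)
  qed
  have "orbits (BijGroup F\<lparr>carrier := generate (BijGroup F) S\<rparr>) F (\<lambda>q. q)
      = (\<lambda>c. {w \<in> F. f w = c}) ` f ` F"
    unfolding orbits_def Setcompr_eq_image image_image using orb by (intro image_cong) auto
  moreover have "inj_on (\<lambda>c. {w \<in> F. f w = c}) (f ` F)"
    by (rule inj_onI) blast
  ultimately show ?thesis by (simp add: card_image)
qed

section \<open>The free product of three groups of order two\<close>

lemma Delta_carrier [simp]: "d \<in> carrier Delta"
  by (simp add: Delta_def)

interpretation Delta: group Delta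
  by (rule Delta_group)

lemma Rgen_cancel: "Rgen k \<otimes>\<^bsub>Delta\<^esub> (Rgen k \<otimes>\<^bsub>Delta\<^esub> d) = d"
  by (simp add: Rgen_square flip: Delta.m_assoc)

lemma Rgen_inv [simp]: "inv\<^bsub>Delta\<^esub> Rgen k = Rgen k"
  by (intro Delta.inv_equality) (simp_all add: Rgen_square)

text \<open>The generators are their own inverses, so every element is a positive word.\<close>

lemma delta_induct [case_names one Rgen]:
  assumes "P \<one>\<^bsub>Delta\<^esub>" and "\<And>k d. P d \<Longrightarrow> P (Rgen k \<otimes>\<^bsub>Delta\<^esub> d)"
  shows "P d"
proof -
  have "P (abs_delta w)" for w
  proof (induction w)
    case Nil
    show ?case using assms(1) by (simp add: Delta_def delta_one_def)
  next
    case (Cons k w)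
    have "abs_delta (k # w) = Rgen k \<otimes>\<^bsub>Delta\<^esub> abs_delta w"
      by (simp add: Delta_def Rgen.abs_eq delta_mult.abs_eq)
    with assms(2)[OF Cons] show ?case by simp
  qed
  then show ?thesis by (metis Quotient3_abs_rep[OF Quotient3_delta])
qed

lemma (in group) normal_closure_normal:
  assumes "S \<subseteq> carrier G"
  shows "normal_closure G S \<lhd> G"
proof -
  have "carrier G \<lhd> G" by (intro normal_invI subgroup_self) auto
  then have "{N. N \<lhd> G \<and> S \<subseteq> N} \<noteq> {}" using assms by blast
  then show ?thesis unfolding normal_closure_def
    by (intro normal_invI subgroups_Inter) (auto dest: normal_invE)
qed

lemma normal_closure_superset: "S \<subseteq> normal_closure G S"
  by (auto simp: normal_closure_def)

lemma normal_closure_minimal: "N \<lhd> G \<Longrightarrow> S \<subseteq> N \<Longrightarrow> normal_closure G S \<subseteq> N"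
  by (auto simp: normal_closure_def)

lemma Delta_0hat_normal: "Delta_0hat \<lhd> Delta"
  unfolding Delta_0hat_def by (rule Delta.normal_closure_normal) auto

text \<open>Left multiplication by a generator respects the partition into \<open>\<Delta>\<^sup>0\<close> and \<open>R\<^sub>0\<Delta>\<^sup>0\<close>: for \<open>R\<^sub>1\<close> and
  \<open>R\<^sub>2\<close> because their conjugates by \<open>R\<^sub>0\<close> lie in \<open>\<Delta>\<^sup>0\<close>. Hence the two cosets exhaust \<open>\<Delta>\<close>.\<close>

lemma Delta_0hat_index_two: "d \<in> Delta_0hat \<or> Rgen I0 \<otimes>\<^bsub>Delta\<^esub> d \<in> Delta_0hat"
proof (induction d rule: delta_induct)
  interpret N: normal Delta_0hat Delta by (rule Delta_0hat_normal)
  case one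
  show ?case by simp
next
  interpret N: normal Delta_0hat Delta by (rule Delta_0hat_normal)
  case (Rgen k d)
  show ?case
  proof (cases "k = I0")
    case True
    with Rgen show ?thesis by (auto simp: Rgen_cancel)
  next
    case False
    then have k: "Rgen k \<in> Delta_0hat"
      using normal_closure_superset[of "{Rgen I1, Rgen I2}" Delta]
      by (cases k) (auto simp: Delta_0hat_def)
    have "Rgen I0 \<otimes>\<^bsub>Delta\<^esub> (Rgen k \<otimes>\<^bsub>Delta\<^esub> d) =
        (Rgen I0 \<otimes>\<^bsub>Delta\<^esub> Rgen k \<otimes>\<^bsub>Delta\<^esub> Rgen I0) \<otimes>\<^bsub>Delta\<^esub> (Rgen I0 \<otimes>\<^bsub>Delta\<^esub> d)"
      by (simp add: Delta.m_assoc Rgen_cancel)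
    moreover have "Rgen I0 \<otimes>\<^bsub>Delta\<^esub> Rgen k \<otimes>\<^bsub>Delta\<^esub> Rgen I0 \<in> Delta_0hat"
      using N.inv_op_closed2[of "Rgen I0"] k by simp
    ultimately show ?thesis using Rgen k by (metis N.m_closed)
  qed
qed

abbreviation even_Delta :: "delta set" where
  "even_Delta \<equiv>
     generate Delta {Rgen I1 \<otimes>\<^bsub>Delta\<^esub> Rgen I2, Rgen I2 \<otimes>\<^bsub>Delta\<^esub> Rgen I0}"

lemma even_Delta_index_two: "d \<in> even_Delta \<or> Rgen I2 \<otimes>\<^bsub>Delta\<^esub> d \<in> even_Delta"
proof (induction d rule: delta_induct)
  case one
  show ?case by (simp add: generate.one)
next
  case (Rgen k d)
  have E: "subgroup even_Delta Delta" by (rule Delta.generate_is_subgroup) auto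
  have 1: "Rgen I1 \<otimes>\<^bsub>Delta\<^esub> Rgen I2 \<in> even_Delta" and 2: "Rgen I2 \<otimes>\<^bsub>Delta\<^esub> Rgen I0 \<in> even_Delta"
    by (auto intro: generate.incl)
  have 3: "Rgen I2 \<otimes>\<^bsub>Delta\<^esub> Rgen I1 \<in> even_Delta" and 4: "Rgen I0 \<otimes>\<^bsub>Delta\<^esub> Rgen I2 \<in> even_Delta"
    using subgroup.m_inv_closed[OF E 1] subgroup.m_inv_closed[OF E 2]
    by (simp_all add: Delta.inv_mult_group)
  have 5: "Rgen I2 \<otimes>\<^bsub>Delta\<^esub> Rgen I2 \<in> even_Delta"
    by (simp add: Rgen_square generate.one)
  have k: "Rgen k \<otimes>\<^bsub>Delta\<^esub> Rgen I2 \<in> even_Delta" "Rgen I2 \<otimes>\<^bsub>Delta\<^esub> Rgen k \<in> even_Delta"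
    using 1 2 3 4 5 by (cases k; simp)+
  from Rgen show ?case
  proof
    assume "d \<in> even_Delta"
    then show ?thesis
      using generate.eng[OF k(2)] by (simp add: Delta.m_assoc)
  next
    assume "Rgen I2 \<otimes>\<^bsub>Delta\<^esub> d \<in> even_Delta"
    then have "Rgen k \<otimes>\<^bsub>Delta\<^esub> Rgen I2 \<otimes>\<^bsub>Delta\<^esub> (Rgen I2 \<otimes>\<^bsub>Delta\<^esub> d) \<in> even_Delta"
      by (rule generate.eng[OF k(1)])
    then show ?thesis by (simp add: Delta.m_assoc Rgen_cancel)
  qed
qed

section \<open>Two-colourings of the flags\<close>

text \<open>Membership of a stabiliser in a subgroup of index two is detected on the flags: if each
  generator either preserves or flips a two-colouring throughout, then so does each element of \<open>\<Delta>\<close>,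
  the colour-preserving elements form a normal subgroup, and an element that fixes one flag belongs
  to it. The colourings used below record the parity of the number of letters \<open>R\<^sub>0\<close>, of the
  number of letters \<open>R\<^sub>1\<close>, \<open>R\<^sub>2\<close>, and of the length of a word.\<close>

lemma act_mult_apply:
  "hypermap H \<Longrightarrow> v \<in> flags H \<Longrightarrow> act H (d \<otimes>\<^bsub>Delta\<^esub> e) v = act H d (act H e v)"
  by (simp add: act_mult compose_eq)

lemma act_one_apply: "hypermap H \<Longrightarrow> v \<in> flags H \<Longrightarrow> act H \<one>\<^bsub>Delta\<^esub> v = v"
  by (simp add: act_one)

lemma act_flags: "hypermap H \<Longrightarrow> v \<in> flags H \<Longrightarrow> act H d v \<in> flags H"
  using act_Bij[of H d] by (auto simp: Bij_def dest: bij_betwE)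

lemma act_inv_cancel: "hypermap H \<Longrightarrow> v \<in> flags H \<Longrightarrow> act H d (act H (inv\<^bsub>Delta\<^esub> d) v) = v"
  by (simp add: act_one_apply flip: act_mult_apply)

lemma stabilizer_Delta_iff: "d \<in> stabilizer Delta (act H) v \<longleftrightarrow> act H d v = v"
  by (simp add: stabilizer_def)

definition colour_preserving :: "'a hypermap \<Rightarrow> ('a \<Rightarrow> bool) \<Rightarrow> delta set" where
  "colour_preserving H \<chi> = {d. \<forall>v\<in>flags H. \<chi> (act H d v) = \<chi> v}"

locale flag_colouring =
  fixes H :: "'a hypermap" and \<chi> :: "'a \<Rightarrow> bool" and flip :: "idx \<Rightarrow> bool"
  assumes H: "hypermap H"
    and perm_colour: "\<And>k v. v \<in> flags H \<Longrightarrow> \<chi> (perm H k v) = (\<chi> v \<noteq> flip k)"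
begin

lemma act_colour: "\<exists>c. \<forall>v\<in>flags H. \<chi> (act H d v) = (\<chi> v \<noteq> c)"
proof (induction d rule: delta_induct)
  case one
  show ?case using act_one_apply[OF H] by auto
next
  case (Rgen k d)
  then obtain c where "\<forall>v\<in>flags H. \<chi> (act H d v) = (\<chi> v \<noteq> c)" by blast
  then have "\<forall>v\<in>flags H. \<chi> (act H (Rgen k \<otimes>\<^bsub>Delta\<^esub> d) v) = (\<chi> v \<noteq> (c \<noteq> flip k))"
    using act_flags[OF H] by (auto simp: act_mult_apply[OF H] act_Rgen[OF H] perm_colour)
  then show ?case by blast
qed

lemma colour_preserving_if_fixes:
  "v \<in> flags H \<Longrightarrow> \<chi> (act H d v) = \<chi> v \<Longrightarrow> d \<in> colour_preserving H \<chi>"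
  using act_colour[of d] unfolding colour_preserving_def by auto

lemma stabilizer_colour_preserving:
  "v \<in> flags H \<Longrightarrow> stabilizer Delta (act H) v \<subseteq> colour_preserving H \<chi>"
  using colour_preserving_if_fixes by (fastforce simp: stabilizer_Delta_iff)

lemma Rgen_colour_preserving: "Rgen k \<in> colour_preserving H \<chi>" if "\<not> flip k"
  using that by (simp add: colour_preserving_def act_Rgen[OF H] perm_colour)

lemma colour_preserving_normal: "colour_preserving H \<chi> \<lhd> Delta"
proof (rule Delta.normal_invI)
  have inv: "inv\<^bsub>Delta\<^esub> d \<in> colour_preserving H \<chi>" if "d \<in> colour_preserving H \<chi>" for d
    unfolding colour_preserving_def
  proof (intro CollectI ballI)
    fix v assume v: "v \<in> flags H"
    then have "\<chi> (act H d (act H (inv\<^bsub>Delta\<^esub> d) v)) = \<chi> (act H (inv\<^bsub>Delta\<^esub> d) v)"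
      using that act_flags[OF H] by (simp add: colour_preserving_def)
    then show "\<chi> (act H (inv\<^bsub>Delta\<^esub> d) v) = \<chi> v"
      by (simp add: act_inv_cancel[OF H v])
  qed
  show "subgroup (colour_preserving H \<chi>) Delta"
  proof (rule Delta.subgroupI)
    have "\<one>\<^bsub>Delta\<^esub> \<in> colour_preserving H \<chi>"
      using act_one_apply[OF H] by (simp add: colour_preserving_def)
    then show "colour_preserving H \<chi> \<noteq> {}" by blast
  qed (use inv act_flags[OF H] in \<open>auto simp: colour_preserving_def act_mult_apply[OF H]\<close>)
  fix d h assume h: "h \<in> colour_preserving H \<chi>"
  show "d \<otimes>\<^bsub>Delta\<^esub> h \<otimes>\<^bsub>Delta\<^esub> inv\<^bsub>Delta\<^esub> d \<in> colour_preserving H \<chi>"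
    unfolding colour_preserving_def
  proof (intro CollectI ballI)
    fix v assume v: "v \<in> flags H"
    obtain c where c: "\<forall>v\<in>flags H. \<chi> (act H d v) = (\<chi> v \<noteq> c)"
      using act_colour by (rule exE)
    have i: "act H (inv\<^bsub>Delta\<^esub> d) v \<in> flags H" by (rule act_flags[OF H v])
    have "\<chi> (act H (d \<otimes>\<^bsub>Delta\<^esub> h \<otimes>\<^bsub>Delta\<^esub> inv\<^bsub>Delta\<^esub> d) v) = (\<chi> (act H (inv\<^bsub>Delta\<^esub> d) v) \<noteq> c)"
      using h i v by (simp add: act_mult_apply[OF H] act_flags[OF H] c[rule_format] colour_preserving_def)
    also have "\<dots> = \<chi> v"
      using c[rule_format, OF i] by (simp add: act_inv_cancel[OF H v])
    finally show "\<chi> (act H (d \<otimes>\<^bsub>Delta\<^esub> h \<otimes>\<^bsub>Delta\<^esub> inv\<^bsub>Delta\<^esub> d) v) = \<chi> v" .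
  qed
qed

lemma Rgen_mult_colour_preserving:
  assumes "flip k" "d \<in> colour_preserving H \<chi>"
  shows "Rgen k \<otimes>\<^bsub>Delta\<^esub> d \<notin> colour_preserving H \<chi>"
proof -
  obtain v where "v \<in> flags H" using H by (auto simp: hypermap_def)
  with assms show ?thesis
    by (auto simp: colour_preserving_def act_mult_apply[OF H] act_Rgen[OF H] perm_colour act_flags[OF H])
qed

text \<open>A colouring that every generator flips is an orientation: \<open>even_Delta\<close> preserves it, and
  \<open>R\<^sub>2\<close> takes \<open>even_Delta\<close> to elements that flip it.\<close>

lemma stabilizer_subset_even_Delta:
  assumes all: "\<And>k. flip k" and v: "v \<in> flags H"
  shows "stabilizer Delta (act H) v \<subseteq> even_Delta"
proof
  fix d assume "d \<in> stabilizer Delta (act H) v"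
  then have d: "d \<in> colour_preserving H \<chi>" using stabilizer_colour_preserving[OF v] by blast
  have "{Rgen I1 \<otimes>\<^bsub>Delta\<^esub> Rgen I2, Rgen I2 \<otimes>\<^bsub>Delta\<^esub> Rgen I0} \<subseteq> colour_preserving H \<chi>"
    by (auto simp: colour_preserving_def act_mult_apply[OF H] act_Rgen[OF H] perm_colour all perm_flags[OF H])
  then have "even_Delta \<subseteq> colour_preserving H \<chi>"
    using Delta.generate_subgroup_incl normal_imp_subgroup[OF colour_preserving_normal] by blast
  then have "Rgen I2 \<otimes>\<^bsub>Delta\<^esub> d \<notin> even_Delta"
    using Rgen_mult_colour_preserving[OF all d] by blast
  then show "d \<in> even_Delta" using even_Delta_index_two by blast
qed

lemma Delta_0hat_eq_colour_preserving:
  assumes "flip I0" "\<not> flip I1" "\<not> flip I2"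
  shows "Delta_0hat = colour_preserving H \<chi>"
proof
  show le: "Delta_0hat \<subseteq> colour_preserving H \<chi>"
    unfolding Delta_0hat_def using assms
    by (intro normal_closure_minimal colour_preserving_normal) (simp add: Rgen_colour_preserving)
  show "colour_preserving H \<chi> \<subseteq> Delta_0hat"
    using Rgen_mult_colour_preserving[OF assms(1)] le Delta_0hat_index_two by blast
qed

end

section \<open>Subgroup indices as orbit lengths\<close>

text \<open>This is the orbit-stabiliser theorem as a statement on cosets: for infinite \<open>N\<close> a product formula for
  orders would say nothing about the index.\<close>

lemma subgroup_index_stabilizer:
  assumes H: "hypermap H" and v: "v \<in> flags H" and N: "subgroup N Delta"
    and K: "stabilizer Delta (act H) v \<subseteq> N"
  shows "subgroup_index Delta N (stabilizer Delta (act H) v) = card {act H d v | d. d \<in> N}"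
proof -
  let ?D = "Delta\<lparr>carrier := N\<rparr>"
  interpret A: group_action Delta "flags H" "act H" by (rule act_group_action[OF H])
  have "act H \<in> hom Delta (BijGroup (flags H))"
    using A.group_hom by (simp add: group_hom_def group_hom_axioms_def)
  then interpret B: group_action ?D "flags H" "act H"
    using Delta.subgroup_imp_group[OF N] group_BijGroup[of "flags H"]
    by (auto simp: group_action_def group_hom_def group_hom_axioms_def hom_def)
  have st: "stabilizer ?D (act H) v = stabilizer Delta (act H) v"
    using K by (auto simp: stabilizer_def)
  let ?f = "\<lambda>R. act H (inv\<^bsub>?D\<^esub> (SOME h. h \<in> R)) v"
  have "?f R \<in> orbit ?D (act H) v" if R: "R \<in> rcosets\<^bsub>?D\<^esub> (stabilizer ?D (act H) v)" for R
  proof -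
    have "(SOME h. h \<in> R) \<in> R"
      using B.stab_rcosets_not_empty[OF v R] by (simp add: some_in_eq)
    moreover have "R \<subseteq> N"
      using subgroup.rcosets_carrier[OF B.stabilizer_subgroup[OF v] Delta.subgroup_imp_group[OF N] R] by simp
    ultimately have "inv\<^bsub>?D\<^esub> (SOME h. h \<in> R) \<in> N"
      using group.inv_closed[OF Delta.subgroup_imp_group[OF N]] by auto
    then show ?thesis by (auto simp: orbit_def)
  qed
  then have "bij_betw ?f (rcosets\<^bsub>?D\<^esub> (stabilizer ?D (act H) v)) (orbit ?D (act H) v)"
    unfolding bij_betw_def
    using B.orbit_stab_fun_is_surj[OF v]
    by (intro conjI inj_onI B.orbit_stab_fun_is_inj[OF v]) (assumption | blast)+
  then show ?thesis
    unfolding subgroup_index_def by (auto simp: st orbit_def dest: bij_betw_same_card)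
qed


section \<open>Bipartite-regular hypermaps with dihedral group\<close>

definition rotation_sign :: "bool \<Rightarrow> int" where
  "rotation_sign e = (if e then - 1 else 1)"

text \<open>The flag with coordinates \<open>(i, e, s)\<close> represents the coset \<open>gK\<close> or \<open>R\<^sub>0gK\<close>, depending on the
  side \<open>s\<close>, where \<open>g\<close> has the image \<open>\<sigma>\<^sup>e\<rho>\<^sup>-\<^sup>i\<close> in the dihedral group. Left multiplication by a reflection
  \<open>\<rho>\<^sup>t\<sigma>\<close> then flips \<open>e\<close> and adds \<open>t\<close> to \<open>i\<close> or subtracts it, depending on \<open>e\<close>. So \<open>R\<^sub>0\<close> changes the side,
  and \<open>R\<^sub>1\<close>, \<open>R\<^sub>2\<close> act with \<open>t = 0\<close> on one side and with \<open>t = x + 1\<close>, \<open>t = x\<close> on the other.\<close>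

locale dihedral_hypermap =
  fixes n :: nat and x :: int
  assumes n_pos: "0 < n"
begin

text \<open>The position is reduced here, so that all calculations can be done with arbitrary integers.\<close>

definition flag :: "int \<Rightarrow> bool \<Rightarrow> bool \<Rightarrow> nat" where
  "flag i e s = to_nat (i mod int n, e, s)"

definition shift :: "idx \<Rightarrow> bool \<Rightarrow> int" where
  "shift k s = (if s then (case k of I0 \<Rightarrow> 0 | I1 \<Rightarrow> x + 1 | I2 \<Rightarrow> x) else 0)"

definition move :: "idx \<Rightarrow> int \<times> bool \<times> bool \<Rightarrow> nat" where
  "move k = (\<lambda>(i, e, s).
     if k = I0 then flag i e (\<not> s) else flag (i + rotation_sign e * shift k s) (\<not> e) s)"

definition all_flags :: "nat set" where
  "all_flags = range (\<lambda>(i, e, s). flag i e s)"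

definition H :: "nat hypermap" where
  "H = \<lparr>flags = all_flags, perm = \<lambda>k. restrict (move k \<circ> from_nat) all_flags\<rparr>"

definition position :: "nat \<Rightarrow> int" where "position v = fst (from_nat v :: int \<times> bool \<times> bool)"
definition sense :: "nat \<Rightarrow> bool" where "sense v = fst (snd (from_nat v :: int \<times> bool \<times> bool))"
definition side :: "nat \<Rightarrow> bool" where "side v = snd (snd (from_nat v :: int \<times> bool \<times> bool))"

lemma flag_coordinates [simp]:
  "position (flag i e s) = i mod int n" "sense (flag i e s) = e" "side (flag i e s) = s"
  by (simp_all add: position_def sense_def side_def flag_def)

lemma flag_eq_iff [simp]:
  "flag i e s = flag j e' s' \<longleftrightarrow> i mod int n = j mod int n \<and> e = e' \<and> s = s'"
  by (auto simp: flag_def)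

lemma flag_in_flags [simp]: "flag i e s \<in> flags H"
  unfolding H_def all_flags_def hypermap.simps by (rule range_eqI[of _ _ "(i, e, s)"]) simp

lemma flags_cases:
  assumes "v \<in> flags H"
  obtains i e s where "v = flag i e s"
  using assms by (auto simp: H_def all_flags_def)

lemma perm_I0 [simp]: "perm H I0 (flag i e s) = flag i e (\<not> s)"
  using flag_in_flags[of i e s] by (auto simp: H_def move_def flag_def)

lemma perm_I12: "k \<noteq> I0 \<Longrightarrow> perm H k (flag i e s) = flag (i + rotation_sign e * shift k s) (\<not> e) s"
  using flag_in_flags[of i e s] by (auto simp: H_def move_def flag_def mod_simps)

lemma rotation_sign_Not [simp]: "rotation_sign (\<not> e) = - rotation_sign e"
  by (simp add: rotation_sign_def)

lemma perm_flag: "\<exists>j e' s'. perm H k (flag i e s) = flag j e' s'"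
  by (cases "k = I0") (auto simp: perm_I12)

lemma perm_closed: "v \<in> flags H \<Longrightarrow> perm H k v \<in> flags H"
  using perm_flag by (metis flags_cases flag_in_flags)

lemma perm_involution: "v \<in> flags H \<Longrightarrow> perm H k (perm H k v) = v"
  by (elim flags_cases) (cases "k = I0"; simp add: perm_I12)

lemma perm_fixpoint_free: "v \<in> flags H \<Longrightarrow> perm H k v \<noteq> v"
  by (elim flags_cases) (cases "k = I0"; simp add: perm_I12)

lemma perm_Bij: "perm H k \<in> Bij (flags H)"
proof -
  have "bij_betw (perm H k) (flags H) (flags H)"
    by (rule bij_betw_byWitness[where f' = "perm H k"])
       (auto simp: perm_involution perm_closed)
  then show ?thesis by (simp add: Bij_def H_def)
qed

lemma flags_eq: "flags H = (\<lambda>(i, e, s). flag i e s) ` ({0..<int n} \<times> UNIV \<times> UNIV)"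
proof -
  have "flag i e s \<in> (\<lambda>(i, e, s). flag i e s) ` ({0..<int n} \<times> UNIV \<times> UNIV)" for i e s
    by (rule image_eqI[of _ _ "(i mod int n, e, s)"]) (use n_pos in auto)
  then show ?thesis by (auto elim!: flags_cases)
qed

lemma card_flags: "card (flags H) = 4 * n"
proof -
  have "inj_on (\<lambda>(i, e, s). flag i e s) ({0..<int n} \<times> UNIV \<times> UNIV)"
    by (auto simp: inj_on_def)
  moreover have "card (UNIV :: (bool \<times> bool) set) = 4"
    by (simp add: card_cartesian_product flip: UNIV_Times_UNIV)
  ultimately show ?thesis
    unfolding flags_eq by (simp add: card_image card_cartesian_product)
qed

subsection \<open>Reachability\<close>

lemma step_I0:
  "v \<in> flags H \<Longrightarrow> I0 \<in> A \<Longrightarrow> linked (flags H) (perm H ` A) v (flag i e s) \<Longrightarrow>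
     linked (flags H) (perm H ` A) v (flag i e s')"
  using linked_step[of "perm H ` A" "flags H" "perm H I0" v "flag i e s"] perm_Bij
  by (cases "s' = s") auto

lemma step_I12:
  "v \<in> flags H \<Longrightarrow> k \<in> A \<Longrightarrow> k \<noteq> I0 \<Longrightarrow> linked (flags H) (perm H ` A) v (flag i e s) \<Longrightarrow>
     linked (flags H) (perm H ` A) v (flag (i + rotation_sign e * shift k s) (\<not> e) s)"
  using linked_step[of "perm H ` A" "flags H" "perm H k" v "flag i e s"] perm_Bij
  by (auto simp: perm_I12)

lemma iterate_rotation:
  fixes m t i :: int
  assumes step: "\<And>i c. c \<in> {1, - 1} \<Longrightarrow> P i \<Longrightarrow> P (i + c * t)" and "P i"
  shows "P (i + m * t)"
proof (induction m rule: int_induct[of _ 0])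
  case base
  show ?case using \<open>P i\<close> by simp
next
  case (step1 m)
  then show ?case using step[of 1 "i + m * t"] by (simp add: algebra_simps)
next
  case (step2 m)
  then show ?case using step[of "- 1" "i + m * t"] by (simp add: algebra_simps)
qed

text \<open>With \<open>R\<^sub>0\<close> and \<open>R\<^sub>k\<close> available, sense and side can be set at will without moving: on the side
  \<open>False\<close>, \<open>R\<^sub>k\<close> only flips the sense. Choosing the sense and then applying \<open>R\<^sub>k\<close> on the side \<open>True\<close>
  moves by the shift in either direction, which with Bezout's identity leaves only the residue of the
  position modulo the greatest common divisor.\<close>

lemma linked_edge_face:
  assumes A: "I0 \<in> A" "k \<in> A" "k \<noteq> I0"
    and ij: "i mod gcd (int n) (shift k True) = j mod gcd (int n) (shift k True)"
  shows "linked (flags H) (perm H ` A) (flag i e s) (flag j e' s')"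
proof -
  define P where "P = (\<lambda>j. \<forall>e' s'. linked (flags H) (perm H ` A) (flag i e s) (flag j e' s'))"
  have free: "P j" if "linked (flags H) (perm H ` A) (flag i e s) (flag j e' s')" for j e' s'
    unfolding P_def
  proof (intro allI)
    fix e'' s''
    have 1: "linked (flags H) (perm H ` A) (flag i e s) (flag j e' False)"
      using step_I0 A that by simp
    have "linked (flags H) (perm H ` A) (flag i e s) (flag j (\<not> e') False)"
      using step_I12[OF _ A(2,3) 1] by (simp add: shift_def)
    with 1 have "linked (flags H) (perm H ` A) (flag i e s) (flag j e'' False)"
      by (cases "e'' = e'") auto
    then show "linked (flags H) (perm H ` A) (flag i e s) (flag j e'' s'')"
      using step_I0 A by simp
  qed
  have "P i" by (rule free[OF linked_refl]) simp
  moreover have "P (j + c * shift k True)" if "c \<in> {1, - 1}" "P j" for c j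
  proof -
    have "c = rotation_sign False \<or> c = rotation_sign True"
      using that(1) by (auto simp: rotation_sign_def)
    then obtain f where f: "c = rotation_sign f" by blast
    have "linked (flags H) (perm H ` A) (flag i e s) (flag j f True)" using that(2) by (simp add: P_def)
    from free[OF step_I12[OF _ A(2,3) this]] show ?thesis by (simp add: f)
  qed
  ultimately have rot: "P (i + m * shift k True)" for m by (rule iterate_rotation[rotated])
  obtain u w where uw: "u * int n + w * shift k True = gcd (int n) (shift k True)"
    using bezout_int by blast
  have "gcd (int n) (shift k True) dvd j - i" using ij by (metis mod_eq_dvd_iff)
  then obtain c where "j - i = gcd (int n) (shift k True) * c" by (auto elim: dvdE)
  also have "\<dots> = int n * (u * c) + (w * c) * shift k True"
    by (simp flip: uw add: algebra_simps)
  finally have "j = (i + (w * c) * shift k True) + int n * (u * c)" by simp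
  then have "flag j e' s' = flag (i + (w * c) * shift k True) e' s'" by simp
  then show ?thesis using rot[of "w * c"] by (simp only: P_def)
qed

text \<open>On the side \<open>True\<close> the shifts of \<open>R\<^sub>1\<close> and \<open>R\<^sub>2\<close> differ by one, so their products in the two
  orders are the two unit rotations.\<close>

lemma linked_vertex:
  assumes A: "I1 \<in> A" "I2 \<in> A" and v: "v \<in> flags H"
    and L: "linked (flags H) (perm H ` A) v (flag i e True)"
  shows "linked (flags H) (perm H ` A) v (flag j e' True)"
proof -
  define P where "P = (\<lambda>e i. linked (flags H) (perm H ` A) v (flag i e True))"
  have step: "P e (i + c * 1)" if "c \<in> {1, - 1}" "P e i" for c i e
  proof -
    have "P e (i + rotation_sign e)"
      using step_I12[OF v A(2) _ step_I12[OF v A(1) _ that(2)[unfolded P_def]]]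
      by (simp add: P_def shift_def algebra_simps)
    moreover have "P e (i - rotation_sign e)"
      using step_I12[OF v A(1) _ step_I12[OF v A(2) _ that(2)[unfolded P_def]]]
      by (simp add: P_def shift_def algebra_simps)
    ultimately show ?thesis using that(1) by (auto simp: rotation_sign_def split: if_splits)
  qed
  have rot: "P e j" if "P e i" for e i j
    using iterate_rotation[of "P e" 1 i "j - i", OF step that] by simp
  have "P (\<not> e) (i + rotation_sign e * shift I1 True)"
    using step_I12[OF v A(1) _ L] by (simp add: P_def)
  then have "P (\<not> e) j" by (rule rot)
  moreover have "P e j" using rot L by (simp add: P_def)
  ultimately show ?thesis by (cases "e' = e") (auto simp: P_def)
qed

lemma hypermap_H: "hypermap H"
  unfolding hypermap_def
proof (intro conjI ballI allI)
  show "finite (flags H)" by (simp add: flags_eq)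
  show "flags H \<noteq> {}" using flag_in_flags by blast
  show "perm H i \<in> carrier (BijGroup (flags H))" for i
    using perm_Bij by (simp add: BijGroup_def)
  show "\<exists>q\<in>generate (BijGroup (flags H)) (range (perm H)). q v = w"
    if vw: "v \<in> flags H" "w \<in> flags H" for v w
  proof -
    obtain i e s j e' s' where v: "v = flag i e s" and w: "w = flag j e' s'"
      using vw by (metis flags_cases)
    have "linked (flags H) (range (perm H)) v (flag i e True)"
      using step_I0[of v UNIV i e s] linked_refl[of v] vw(1) v by simp
    then have "linked (flags H) (range (perm H)) v (flag j e' True)"
      using linked_vertex[of UNIV v] vw by blast
    then have "linked (flags H) (range (perm H)) v w"
      using step_I0[of v UNIV j e' True] vw w by simp
    then show ?thesis by (simp add: linked_def)
  qed
qed (auto simp: perm_fixpoint_free perm_involution)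

subsection \<open>Euler characteristic\<close>

lemma faces_eq:
  "faces H k = orbits (BijGroup (flags H)
      \<lparr>carrier := generate (BijGroup (flags H)) (perm H ` {i. i \<noteq> k})\<rparr>) (flags H) (\<lambda>q. q)"
  by (simp add: faces_def setcompr_eq_image)

text \<open>The residue of the position modulo the greatest common divisor is the complete invariant.\<close>

lemma card_edges_faces:
  assumes k: "{i. i \<noteq> k'} = {I0, k}" "k \<noteq> I0"
  shows "int (card (faces H k')) = gcd (int n) (shift k True)"
proof -
  define d where "d = gcd (int n) (shift k True)"
  define r where "r = (\<lambda>v. position v mod d)"
  have d: "d > 0" "d dvd int n" using n_pos by (simp_all add: d_def)
  have r: "r (flag i e s) = i mod d" for i e s
    using d(2) by (simp add: r_def mod_mod_cancel)
  have "d dvd shift k s" for s by (cases s) (auto simp: shift_def d_def)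
  then have "(i + rotation_sign e * shift k s) mod d = i mod d" for i e s
    by (simp add: mod_eq_dvd_iff)
  then have inv: "r (perm H l (flag i e s)) = r (flag i e s)" if "l \<in> {I0, k}" for l i e s
    using that k(2) by (auto simp: r perm_I12)
  have "card (faces H k') = card (r ` flags H)"
    unfolding faces_eq k(1)
  proof (rule card_orbits_generate)
    show "perm H ` {I0, k} \<subseteq> Bij (flags H)" using perm_Bij by blast
    show "r (p v) = r v" if "p \<in> perm H ` {I0, k}" "v \<in> flags H" for p v
    proof -
      obtain l where "l \<in> {I0, k}" "p = perm H l" using \<open>p \<in> perm H ` {I0, k}\<close> by blast
      moreover obtain i e s where "v = flag i e s" using \<open>v \<in> flags H\<close> by (rule flags_cases)
      ultimately show ?thesis using inv by simp
    qed
    show "linked (flags H) (perm H ` {I0, k}) v w" if vw: "v \<in> flags H" "w \<in> flags H" "r v = r w" for v w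
    proof -
      obtain i e s j e' s' where "v = flag i e s" "w = flag j e' s'"
        using vw by (metis flags_cases)
      moreover from this have "i mod d = j mod d" using vw(3) by (simp add: r)
      ultimately show ?thesis
        using linked_edge_face[of "{I0, k}" k i j e s e' s'] k(2) by (simp add: d_def del: image_insert)
    qed
  qed
  also have "r ` flags H = {0..<d}"
  proof (intro equalityI subsetI)
    fix c assume "c \<in> {0..<d}"
    then have "c = r (flag c False False)" by (simp add: r)
    then show "c \<in> r ` flags H" by (rule image_eqI) simp
  qed (use d in \<open>auto simp: r_def\<close>)
  finally show ?thesis using d by (simp add: d_def)
qed

text \<open>All flags on the side \<open>True\<close> form one vertex. On the other side \<open>R\<^sub>1\<close> and \<open>R\<^sub>2\<close> both just flip the
  sense, so there is one vertex for each of the \<open>n\<close> positions. The invariant gives the single vertex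
  the value \<open>n\<close>, which is not a position.\<close>

lemma card_vertices: "card (faces H I0) = n + 1"
proof -
  let ?f = "\<lambda>v. if side v then int n else position v"
  have not_I0: "{i. i \<noteq> I0} = {I1, I2}" using idx.exhaust by auto
  have "card (faces H I0) = card (?f ` flags H)"
    unfolding faces_eq not_I0
  proof (rule card_orbits_generate)
    show "perm H ` {I1, I2} \<subseteq> Bij (flags H)" using perm_Bij by blast
    show "?f (p v) = ?f v" if "p \<in> perm H ` {I1, I2}" "v \<in> flags H" for p v
      using that by (auto elim!: flags_cases simp: perm_I12 shift_def)
    show "linked (flags H) (perm H ` {I1, I2}) v w" if vw: "v \<in> flags H" "w \<in> flags H" "?f v = ?f w" for v w
    proof -
      obtain i e s j e' s' where v: "v = flag i e s" and w: "w = flag j e' s'"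
        using vw by (metis flags_cases)
      have L: "linked (flags H) (perm H ` {I1, I2}) v (flag i e s)"
        using linked_refl vw(1) v by metis
      have lt: "i mod int n < int n" for i using n_pos by simp
      have s: "s' = s" using vw(3) lt[of i] lt[of j] by (auto simp: v w split: if_splits)
      show ?thesis
      proof (cases s)
        case True
        then show ?thesis using linked_vertex[of "{I1, I2}" v i e j e'] vw(1) L
          by (simp add: w s del: image_insert)
      next
        case False
        then have ij: "i mod int n = j mod int n" using vw(3) s by (simp add: v w)
        have "linked (flags H) (perm H ` {I1, I2}) v (flag i (\<not> e) s)"
          using step_I12[OF vw(1) _ _ L, of I1] False by (simp add: shift_def)
        moreover have "w = flag i e s \<or> w = flag i (\<not> e) s" using ij by (auto simp: w s)
        ultimately show ?thesis using L by auto
      qed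
    qed
  qed
  also have "?f ` flags H = {0..int n}"
  proof (intro equalityI subsetI)
    fix c assume c: "c \<in> {0..int n}"
    then have "c = ?f (flag c False (c = int n))" by auto
    then show "c \<in> ?f ` flags H" by (rule image_eqI) simp
  next
    fix c assume "c \<in> ?f ` flags H"
    then show "c \<in> {0..int n}"
      using n_pos by (auto elim!: flags_cases intro: less_imp_le)
  qed
  finally show ?thesis by (simp add: nat_add_distrib)
qed

lemma euler_char_H:
  "euler_char H = of_int (1 + gcd (int n) x + gcd (int n) (x + 1) - int n)"
proof -
  have "{i. i \<noteq> I1} = {I0, I2}" "{i. i \<noteq> I2} = {I0, I1}" using idx.exhaust by auto
  then have "int (card (faces H I1)) = gcd (int n) x" "int (card (faces H I2)) = gcd (int n) (x + 1)"
    using card_edges_faces[of I1 I2] card_edges_faces[of I2 I1] by (simp_all add: shift_def)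
  then have "real (card (faces H I1)) = of_int (gcd (int n) x)"
    "real (card (faces H I2)) = of_int (gcd (int n) (x + 1))" by linarith+
  then show ?thesis by (simp add: euler_char_def card_vertices card_flags)
qed

subsection \<open>Orientability and bipartite regularity\<close>

interpretation sense: flag_colouring H sense "\<lambda>k. k \<noteq> I0"
proof
  show "sense (perm H k v) = (sense v \<noteq> (k \<noteq> I0))" if v: "v \<in> flags H" for k v
  proof -
    obtain i e s where "v = flag i e s" using v by (rule flags_cases)
    then show ?thesis by (cases "k = I0") (simp_all add: perm_I12)
  qed
qed (rule hypermap_H)

interpretation side: flag_colouring H side "\<lambda>k. k = I0"
proof
  show "side (perm H k v) = (side v \<noteq> (k = I0))" if v: "v \<in> flags H" for k v
  proof -
    obtain i e s where "v = flag i e s" using v by (rule flags_cases)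
    then show ?thesis by (cases "k = I0") (simp_all add: perm_I12)
  qed
qed (rule hypermap_H)

interpretation orientation: flag_colouring H "\<lambda>v. sense v \<noteq> side v" "\<lambda>k. True"
proof
  show "(sense (perm H k v) \<noteq> side (perm H k v)) = ((sense v \<noteq> side v) \<noteq> True)"
    if v: "v \<in> flags H" for k v
  proof -
    obtain i e s where "v = flag i e s" using v by (rule flags_cases)
    then show ?thesis by (cases "k = I0") (auto simp: perm_I12)
  qed
qed (rule hypermap_H)

lemma stabilizer_subgroup: "v \<in> flags H \<Longrightarrow> subgroup (stabilizer Delta (act H) v) Delta"
  by (rule group_action.stabilizer_subgroup[OF act_group_action[OF hypermap_H]])

text \<open>Every element acts on the coordinates with constants that depend only on the side: relative to the
  sense, each side is rotated rigidly.\<close>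

lemma act_formula:
  "\<exists>t f b. \<forall>i e s. act H d (flag i e s) = flag (i + rotation_sign e * t s) (e \<noteq> f) (s \<noteq> b)"
proof (induction d rule: delta_induct)
  case one
  show ?case
    by (rule exI[of _ "\<lambda>_. 0"]) (auto simp: act_one_apply[OF hypermap_H])
next
  case (Rgen k d)
  then obtain t f b where d:
    "\<forall>i e s. act H d (flag i e s) = flag (i + rotation_sign e * t s) (e \<noteq> f) (s \<noteq> b)"
    by (elim exE) (rule that)
  have R: "act H (Rgen k \<otimes>\<^bsub>Delta\<^esub> d) (flag i e s) =
      perm H k (flag (i + rotation_sign e * t s) (e \<noteq> f) (s \<noteq> b))" for i e s
    by (simp add: act_mult_apply[OF hypermap_H] act_Rgen[OF hypermap_H] d[rule_format])
  show ?case
  proof (cases "k = I0")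
    case True
    show ?thesis
      by (rule exI[of _ t], rule exI[of _ f], rule exI[of _ "\<not> b"]) (simp only: R, auto simp: True)
  next
    case False
    have sg: "rotation_sign (e = (\<not> f)) = rotation_sign e * rotation_sign f" for e
      by (simp add: rotation_sign_def)
    show ?thesis
      by (rule exI[of _ "\<lambda>s. t s + rotation_sign f * shift k (s \<noteq> b)"], rule exI[of _ "\<not> f"],
          rule exI[of _ b]) (auto simp: R perm_I12[OF False] sg algebra_simps)
  qed
qed

text \<open>The constants of an element with fixed points are \<open>f = b = False\<close> and \<open>t s \<equiv> 0\<close>, a condition on
  the side alone.\<close>

lemma stabilizer_same_side:
  "stabilizer Delta (act H) (flag i e s) = stabilizer Delta (act H) (flag j e' s)"
proof -
  have fix_iff: "(i + rotation_sign e * t) mod int n = i mod int n \<longleftrightarrow> int n dvd t" for i e t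
    by (auto simp: mod_eq_dvd_iff rotation_sign_def)
  have "act H d (flag i e s) = flag i e s \<longleftrightarrow> act H d (flag j e' s) = flag j e' s" for d
  proof -
    obtain t f b where
      "\<forall>i e s. act H d (flag i e s) = flag (i + rotation_sign e * t s) (e \<noteq> f) (s \<noteq> b)"
      using act_formula[of d] by (elim exE) (rule that)
    then show ?thesis by (cases f; cases b) (simp_all add: fix_iff)
  qed
  then show ?thesis by (auto simp: stabilizer_Delta_iff)
qed

text \<open>Conjugation by \<open>d\<close> moves the stabiliser of \<open>d\<^sup>-\<^sup>1v\<close> to that of \<open>v\<close>, and for \<open>d\<close> in \<open>\<Delta>\<^sup>0\<close> both flags
  lie on the same side.\<close>

lemma stabilizer_normal_Delta_0hat:
  assumes v: "v \<in> flags H"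
  shows "stabilizer Delta (act H) v \<lhd> Delta\<lparr>carrier := Delta_0hat\<rparr>"
proof -
  have eq: "Delta_0hat = colour_preserving H side"
    by (rule side.Delta_0hat_eq_colour_preserving) auto
  have N: "subgroup Delta_0hat Delta" by (rule normal_imp_subgroup[OF Delta_0hat_normal])
  interpret N: group "Delta\<lparr>carrier := Delta_0hat\<rparr>" by (rule Delta.subgroup_imp_group[OF N])
  show ?thesis
  proof (rule N.normal_invI)
    show "subgroup (stabilizer Delta (act H) v) (Delta\<lparr>carrier := Delta_0hat\<rparr>)"
      using side.stabilizer_colour_preserving[OF v] stabilizer_subgroup[OF v] N
      by (intro Delta.subgroup_incl) (auto simp: eq)
    fix d h assume d: "d \<in> carrier (Delta\<lparr>carrier := Delta_0hat\<rparr>)"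
      and h: "h \<in> stabilizer Delta (act H) v"
    let ?w = "act H (inv\<^bsub>Delta\<^esub> d) v"
    have "inv\<^bsub>Delta\<^esub> d \<in> colour_preserving H side"
      using d subgroup.m_inv_closed[OF N, of d] by (simp add: eq)
    then have "side ?w = side v" using v by (simp add: colour_preserving_def)
    obtain i e s where w: "?w = flag i e s"
      using act_flags[OF hypermap_H v] by (rule flags_cases)
    obtain j e' s' where v': "v = flag j e' s'" using v by (rule flags_cases)
    have "s = s'" using \<open>side ?w = side v\<close> unfolding w by (simp add: v')
    then have "stabilizer Delta (act H) ?w = stabilizer Delta (act H) v"
      unfolding w unfolding v' using stabilizer_same_side by blast
    with h have "act H h ?w = ?w" by (auto simp: stabilizer_Delta_iff)
    then have "act H (d \<otimes>\<^bsub>Delta\<^esub> h \<otimes>\<^bsub>Delta\<^esub> inv\<^bsub>Delta\<^esub> d) v = v"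
      by (simp add: act_mult_apply[OF hypermap_H] act_flags[OF hypermap_H] v act_inv_cancel[OF hypermap_H])
    then show "d \<otimes>\<^bsub>Delta\<lparr>carrier := Delta_0hat\<rparr>\<^esub> h \<otimes>\<^bsub>Delta\<lparr>carrier := Delta_0hat\<rparr>\<^esub>
        inv\<^bsub>Delta\<lparr>carrier := Delta_0hat\<rparr>\<^esub> d \<in> stabilizer Delta (act H) v"
      using d N by (simp add: stabilizer_Delta_iff Delta.m_inv_consistent)
  qed
qed

subsection \<open>Irregularity index\<close>

text \<open>The element \<open>\<kappa> = R\<^sub>2R\<^sub>1\<close> is trivial on the side \<open>False\<close> and a unit rotation on the side \<open>True\<close>;
  for \<open>\<kappa>' = R\<^sub>0\<kappa>R\<^sub>0\<close> it is the other way round. So whichever side \<open>s\<close> is, one of the two stabilises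
  its flags and the other, being conjugate to it, is the required rotation.\<close>

lemma rotation_in_normal_closure:
  "\<exists>d \<in> normal_closure Delta (stabilizer Delta (act H) (flag i e s)).
     \<forall>j e. act H d (flag j e s) = flag (j + rotation_sign e) e s"
proof -
  let ?N = "normal_closure Delta (stabilizer Delta (act H) (flag i e s))"
  define \<kappa> where "\<kappa> = Rgen I2 \<otimes>\<^bsub>Delta\<^esub> Rgen I1"
  define \<kappa>' where "\<kappa>' = Rgen I0 \<otimes>\<^bsub>Delta\<^esub> \<kappa> \<otimes>\<^bsub>Delta\<^esub> Rgen I0"
  note act_simps = act_mult_apply[OF hypermap_H] act_Rgen[OF hypermap_H] perm_I12 shift_def algebra_simps
  have k: "act H \<kappa> (flag j e s) = flag (j + (if s then rotation_sign e else 0)) e s" for j e s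
    by (simp add: \<kappa>_def act_simps)
  have k': "act H \<kappa>' (flag j e s) = flag (j + (if s then 0 else rotation_sign e)) e s" for j e s
    by (simp add: \<kappa>'_def act_mult_apply[OF hypermap_H] act_Rgen[OF hypermap_H] k)
  interpret N: normal ?N Delta by (rule Delta.normal_closure_normal) auto
  have conj: "Rgen I0 \<otimes>\<^bsub>Delta\<^esub> d \<otimes>\<^bsub>Delta\<^esub> Rgen I0 \<in> ?N" if "d \<in> ?N" for d
    using N.inv_op_closed2[of "Rgen I0" d] that by simp
  show ?thesis
  proof (cases s)
    case False
    then have "\<kappa> \<in> ?N"
      using k[of i e s] normal_closure_superset by (force simp: stabilizer_Delta_iff)
    then have "\<kappa>' \<in> ?N" unfolding \<kappa>'_def by (rule conj)
    then show ?thesis using k' False by (intro bexI[of _ \<kappa>']) auto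
  next
    case True
    then have "\<kappa>' \<in> ?N"
      using k'[of i e s] normal_closure_superset by (force simp: stabilizer_Delta_iff)
    moreover have "Rgen I0 \<otimes>\<^bsub>Delta\<^esub> \<kappa>' \<otimes>\<^bsub>Delta\<^esub> Rgen I0 = \<kappa>"
      by (simp add: \<kappa>'_def Delta.m_assoc Rgen_cancel Rgen_square)
    ultimately have "\<kappa> \<in> ?N" using conj by metis
    then show ?thesis using k True by (intro bexI[of _ \<kappa>]) auto
  qed
qed

text \<open>The normal closure preserves sense and side, since the stabiliser does, and it contains a unit
  rotation.\<close>

lemma orbit_normal_closure:
  "{act H d (flag i e s) | d. d \<in> normal_closure Delta (stabilizer Delta (act H) (flag i e s))}
     = range (\<lambda>j. flag j e s)"
proof (intro equalityI subsetI)
  let ?N = "normal_closure Delta (stabilizer Delta (act H) (flag i e s))"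
  fix w assume "w \<in> {act H d (flag i e s) | d. d \<in> ?N}"
  then obtain d where d: "d \<in> ?N" "w = act H d (flag i e s)" by blast
  have "?N \<subseteq> colour_preserving H sense" "?N \<subseteq> colour_preserving H side"
    by (intro normal_closure_minimal sense.colour_preserving_normal side.colour_preserving_normal
          sense.stabilizer_colour_preserving side.stabilizer_colour_preserving flag_in_flags)+
  with d have "sense w = e" "side w = s" by (auto simp: colour_preserving_def)
  moreover have "w \<in> flags H" using d act_flags[OF hypermap_H] by simp
  ultimately show "w \<in> range (\<lambda>j. flag j e s)" by (auto elim!: flags_cases)
next
  let ?N = "normal_closure Delta (stabilizer Delta (act H) (flag i e s))"
  interpret N: normal ?N Delta by (rule Delta.normal_closure_normal) auto
  obtain r where r: "r \<in> ?N" "\<And>j e. act H r (flag j e s) = flag (j + rotation_sign e) e s"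
    using rotation_in_normal_closure by blast
  have iter: "\<exists>d\<in>?N. act H d (flag i e s) = flag (i + int m * rotation_sign e) e s" for m
  proof (induction m)
    case 0
    show ?case by (rule bexI[of _ "\<one>\<^bsub>Delta\<^esub>"]) (simp_all add: act_one_apply[OF hypermap_H])
  next
    case (Suc m)
    then obtain d where "d \<in> ?N" "act H d (flag i e s) = flag (i + int m * rotation_sign e) e s" by blast
    then show ?case
      using r by (intro bexI[of _ "r \<otimes>\<^bsub>Delta\<^esub> d"]) (auto simp: act_mult_apply[OF hypermap_H] algebra_simps)
  qed
  fix w assume "w \<in> range (\<lambda>j. flag j e s)"
  then obtain j where w: "w = flag j e s" by blast
  \<comment> \<open>The sign compensates for the direction in which the rotation moves flags of sense \<open>e\<close>.\<close>
  define m where "m = nat (((j - i) * rotation_sign e) mod int n)"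
  have "int m mod int n = ((j - i) * rotation_sign e) mod int n" using n_pos by (simp add: m_def)
  then have "(i + int m * rotation_sign e) mod int n = (i + (j - i) * rotation_sign e * rotation_sign e) mod int n"
    by (metis mod_add_cong mod_mult_cong)
  also have "\<dots> = j mod int n" by (simp add: rotation_sign_def)
  finally have "w = flag (i + int m * rotation_sign e) e s" by (simp add: w)
  then show "w \<in> {act H d (flag i e s) | d. d \<in> ?N}" using iter[of m] by force
qed

lemma card_rotation_orbit: "card (range (\<lambda>j. flag j e s)) = n"
proof -
  have "flag j e s = flag (j mod int n) e s" for j by simp
  moreover have "j mod int n \<in> {0..<int n}" for j using n_pos by simp
  ultimately have "range (\<lambda>j. flag j e s) = (\<lambda>j. flag j e s) ` {0..<int n}" by blast
  moreover have "inj_on (\<lambda>j. flag j e s) {0..<int n}" by (auto simp: inj_on_def)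
  ultimately show ?thesis by (simp add: card_image)
qed

lemma index_stabilizer:
  assumes "v \<in> flags H"
  shows "subgroup_index Delta (normal_closure Delta (stabilizer Delta (act H) v))
           (stabilizer Delta (act H) v) = n"
proof -
  obtain i e s where v: "v = flag i e s" using assms by (rule flags_cases)
  have "subgroup (normal_closure Delta (stabilizer Delta (act H) v)) Delta"
    by (intro normal_imp_subgroup Delta.normal_closure_normal) auto
  from subgroup_index_stabilizer[OF hypermap_H assms this normal_closure_superset]
  show ?thesis by (simp add: v orbit_normal_closure card_rotation_orbit)
qed

lemma stabilizer_not_normal:
  assumes v: "v \<in> flags H" and "n \<ge> 2"
  shows "\<not> stabilizer Delta (act H) v \<lhd> Delta"
proof
  let ?K = "stabilizer Delta (act H) v"
  assume "?K \<lhd> Delta"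
  then have "normal_closure Delta ?K = ?K"
    using normal_closure_superset normal_closure_minimal by (metis order_refl subset_antisym)
  moreover have "{act H d v | d. d \<in> ?K} = {v}"
    using act_one_apply[OF hypermap_H v] by (force simp: stabilizer_Delta_iff)
  ultimately have "n = 1"
    using index_stabilizer[OF v] subgroup_index_stabilizer[OF hypermap_H v stabilizer_subgroup[OF v]]
    by simp
  with \<open>n \<ge> 2\<close> show False by simp
qed

lemma dihedral_hypermap_chiral:
  assumes "n \<ge> 2" and genus: "gcd (int n) x + gcd (int n) (x + 1) = int n + 1 - 2 * int g"
  shows "hypermap H \<and> on_orientable_surface H g \<and> bipartite_chiral H \<and> irregularity_index H = n"
proof -
  define v where "v = (SOME v. v \<in> flags H)"
  have v: "v \<in> flags H" unfolding v_def using flag_in_flags by (rule someI)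
  have K: "hypermap_subgroup H = stabilizer Delta (act H) v"
    by (simp add: hypermap_subgroup_def v_def)
  have "euler_char H = 2 - 2 * real g"
    using genus by (simp add: euler_char_H)
  moreover have "orientable H"
    unfolding orientable_def K using orientation.stabilizer_subset_even_Delta[OF _ v] by simp
  moreover have "bipartite_chiral H"
    unfolding bipartite_chiral_def bipartite_regular_def regular_def K
    using stabilizer_normal_Delta_0hat[OF v] stabilizer_not_normal[OF v assms(1)] by blast
  ultimately show ?thesis
    using hypermap_H index_stabilizer[OF v]
    by (simp add: on_orientable_surface_def irregularity_index_def K)
qed

end

lemma ex_chiral_hypermap:
  assumes "n \<ge> 2" and "gcd (int n) x + gcd (int n) (x + 1) = int n + 1 - 2 * int g"
  shows "\<exists>H :: nat hypermap. hypermap H \<and> on_orientable_surface H g \<and>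
           bipartite_chiral H \<and> irregularity_index H = n"
proof -
  interpret dihedral_hypermap n x using assms(1) by unfold_locales simp
  show ?thesis using dihedral_hypermap_chiral[OF assms] by blast
qed

theorem theorem23:
  fixes g :: nat
  shows "(g \<ge> 1 \<longrightarrow>
            (\<exists>H :: nat hypermap. hypermap H \<and> on_orientable_surface H g \<and>
               bipartite_chiral H \<and> irregularity_index H = 2 * g + 1)) \<and>
         (\<exists>H :: nat hypermap. hypermap H \<and> on_orientable_surface H g \<and>
               bipartite_chiral H \<and> irregularity_index H = 4 * g + 2) \<and>
         (g \<ge> 1 \<longrightarrow>
            (\<exists>H :: nat hypermap. hypermap H \<and> on_orientable_surface H g \<and>
               bipartite_chiral H \<and> irregularity_index H = 4 * g))"
proof (intro conjI impI)
  assume "g \<ge> 1"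
  have "coprime (int (2 * g + 1)) 2" by simp
  then have "gcd (int (2 * g + 1)) (1 + 1) = 1" by (simp add: coprime_iff_gcd_eq_1)
  then show "\<exists>H :: nat hypermap. hypermap H \<and> on_orientable_surface H g \<and>
           bipartite_chiral H \<and> irregularity_index H = 2 * g + 1"
    using \<open>g \<ge> 1\<close> by (intro ex_chiral_hypermap[where x = 1]) simp_all
next
  have "coprime (2 * int g + 1) (int g + 1)"
  proof (rule coprimeI)
    fix c assume "c dvd 2 * int g + 1" "c dvd int g + 1"
    then have "c dvd 2 * (int g + 1) - (2 * int g + 1)" by (intro dvd_diff dvd_mult)
    then show "c dvd 1" by simp
  qed
  then have "gcd (2 * (2 * int g + 1)) (2 * (int g + 1)) = 2"
    by (subst gcd_mult_distrib_int[symmetric]) (simp add: coprime_iff_gcd_eq_1)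
  moreover have "int (4 * g + 2) = 2 * (2 * int g + 1)" "2 * int g + 1 + 1 = 2 * (int g + 1)" by simp_all
  ultimately have "gcd (int (4 * g + 2)) (2 * int g + 1 + 1) = 2" by metis
  moreover have "gcd (int (4 * g + 2)) (2 * int g + 1) = 2 * int g + 1"
    unfolding \<open>int (4 * g + 2) = 2 * (2 * int g + 1)\<close>
    by (subst gcd_proj2_if_dvd[OF dvd_triv_right]) simp
  ultimately show "\<exists>H :: nat hypermap. hypermap H \<and> on_orientable_surface H g \<and>
           bipartite_chiral H \<and> irregularity_index H = 4 * g + 2"
    by (intro ex_chiral_hypermap[where x = "2 * int g + 1"]) linarith+
next
  assume "g \<ge> 1"
  have "coprime (int (4 * g)) (2 * int g + 1)"
  proof (rule coprimeI)
    fix c assume "c dvd int (4 * g)" "c dvd 2 * int g + 1"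
    \<comment> \<open>The Bezout combination \<open>(2g + 1)\<^sup>2 - 4g(g + 1) = 1\<close>.\<close>
    then have "c dvd (2 * int g + 1) * (2 * int g + 1) - (int g + 1) * int (4 * g)"
      by (intro dvd_diff dvd_mult)
    then show "c dvd 1" by (simp add: algebra_simps)
  qed
  then have "gcd (int (4 * g)) (2 * int g + 1) = 1" by (simp only: coprime_iff_gcd_eq_1)
  moreover have "gcd (int (4 * g)) (2 * int g) = 2 * int g"
    by (subst gcd_proj2_if_dvd) simp_all
  ultimately show "\<exists>H :: nat hypermap. hypermap H \<and> on_orientable_surface H g \<and>
           bipartite_chiral H \<and> irregularity_index H = 4 * g"
    using \<open>g \<ge> 1\<close> by (intro ex_chiral_hypermap[where x = "2 * int g"]) linarith+
qed

end
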